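(* Let $p$ be a prime and let $f:\mathbb{Z}_p\to\mathbb{Z}_p$ be a 1-Lipschitz function with van der Put expansion $f(x)=\sum_{m=0}^{\infty}B_m\chi(m,x)$. Suppose that (1) $B_0,B_1,\dots,B_{p-1}$ are pairwise distinct modulo $p$; and (2) $B_m\equiv q(m)\pmod{p^{\lfloor \log_p m\rfloor+1}}$ for all integers $m\ge p$. Then $f$ is measure-preserving.
   Context: $\mathbb{Z}_p$ is the ring of $p$-adic integers with absolute value $|x|_p=p^{-\mathrm{ord}(x)}$ and normalized Haar measure $\mu_p$ ($\mu_p(a+p^k\mathbb{Z}_p)=p^{-k}$). A function $f:\mathbb{Z}_p\to\mathbb{Z}_p$ is 1-Lipschitz if $|f(x)-f(y)|_p\le|x-y|_p$ for all $x,y$; it is measure-preserving if $\mu_p(f^{-1}(S))=\mu_p(S)$ for every measurable $S$. For an integer $m>0$ with base-$p$ expansion $m=m_0+m_1p+\dots+m_sp^s$ ($0\le m_i\le p-1$, $m_s\ne0$), so $s=\lfloor\log_p m\rfloor$, put $q(m)=m_sp^s$. The van der Put basis is: for $m>0$, $\chi(m,x)=1$ if $|x-m|_p\le p^{-\lfloor\log_p m\rfloor-1}$ and $0$ otherwise; $\chi(0,x)=1$ if $|x|_p\le p^{-1}$ and $0$ otherwise. Every continuous $f:\mathbb{Z}_p\to\mathbb{Z}_p$ has a unique expansion $f(x)=\sum_{m\ge0}B_m\chi(m,x)$ with $B_m\in\mathbb{Z}_p$, where $B_m=f(m)$ for $0\le m\le p-1$ and $B_m=f(m)-f(m-q(m))$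 for $m\ge p$. *)

theory Defs
  imports
    "HOL-Probability.Probability"
    "HOL-Computational_Algebra.Primes"
    "HOL-Algebra.Ideal"
begin

section \<open>The ring of p-adic integers\<close>

text \<open>
  \<open>Zp p\<close> is the inverse limit of the residue rings \<open>\<int>/p\<^sup>n\<close>: an element is the sequence of its
  residues modulo \<open>p\<^sup>0, p\<^sup>1, p\<^sup>2, \<dots>\<close>, each taken in \<open>{0..<p\<^sup>n}\<close>.
\<close>

definition Zp :: "nat \<Rightarrow> (nat \<Rightarrow> int) ring" where
  "Zp p =
    \<lparr> carrier = {x. \<forall>n. x n \<in> {0..<int p ^ n} \<and> x (Suc n) mod int p ^ n = x n},
      monoid.mult = (\<lambda>x y n. x n * y n mod int p ^ n),
      one = (\<lambda>n. 1 mod int p ^ n),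
      zero = (\<lambda>n. 0),
      add = (\<lambda>x y n. (x n + y n) mod int p ^ n) \<rparr>"

abbreviation padic_of_nat :: "nat \<Rightarrow> nat \<Rightarrow> nat \<Rightarrow> int" where
  "padic_of_nat p m \<equiv> [m] \<cdot>\<^bsub>Zp p\<^esub> \<one>\<^bsub>Zp p\<^esub>"

definition padic_pow_ideal :: "nat \<Rightarrow> nat \<Rightarrow> (nat \<Rightarrow> int) set" where
  "padic_pow_ideal p n = PIdl\<^bsub>Zp p\<^esub> (padic_of_nat p (p ^ n))"

definition padic_cong :: "nat \<Rightarrow> nat \<Rightarrow> (nat \<Rightarrow> int) \<Rightarrow> (nat \<Rightarrow> int) \<Rightarrow> bool" where
  "padic_cong p n x y \<longleftrightarrow> x \<ominus>\<^bsub>Zp p\<^esub> y \<in> padic_pow_ideal p n"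

text \<open>The value of \<open>padic_ord\<close> at zero is irrelevant.\<close>

definition padic_ord :: "nat \<Rightarrow> (nat \<Rightarrow> int) \<Rightarrow> nat" where
  "padic_ord p x = (GREATEST n. x \<in> padic_pow_ideal p n)"

definition padic_abs :: "nat \<Rightarrow> (nat \<Rightarrow> int) \<Rightarrow> real" where
  "padic_abs p x = (if x = \<zero>\<^bsub>Zp p\<^esub> then 0 else 1 / real p ^ padic_ord p x)"

text \<open>
  The locale \<open>Metric_space\<close> wants a distance that is nonnegative and symmetric on the whole type,
  whence the value 0 outside the carrier.
\<close>

definition padic_dist :: "nat \<Rightarrow> (nat \<Rightarrow> int) \<Rightarrow> (nat \<Rightarrow> int) \<Rightarrow> real" where
  "padic_dist p x y =
    (if x \<in> carrier (Zp p) \<and> y \<in> carrier (Zp p) then padic_abs p (x \<ominus>\<^bsub>Zp p\<^esub> y) else 0)"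

definition padic_topology :: "nat \<Rightarrow> (nat \<Rightarrow> int) topology" where
  "padic_topology p = Metric_space.mtopology (carrier (Zp p)) (padic_dist p)"

definition padic_borel :: "nat \<Rightarrow> (nat \<Rightarrow> int) measure" where
  "padic_borel p = sigma (carrier (Zp p)) {U. openin (padic_topology p) U}"

definition is_padic_haar :: "nat \<Rightarrow> (nat \<Rightarrow> int) measure \<Rightarrow> bool" where
  "is_padic_haar p M \<longleftrightarrow>
    sets M = sets (padic_borel p) \<and>
    emeasure M (carrier (Zp p)) = 1 \<and>
    (\<forall>a\<in>carrier (Zp p). \<forall>S\<in>sets M. emeasure M (a <+\<^bsub>Zp p\<^esub> S) = emeasure M S)"

text \<open>
  Existence and uniqueness, and the value \<open>p\<^sup>-\<^sup>k\<close> on \<open>a + p\<^sup>k \<int>\<^sub>p\<close>, are proved below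
  (\<open>is_padic_haar_padic_haar\<close>, \<open>is_padic_haar_unique\<close>, \<open>emeasure_padic_haar_ball\<close>).
\<close>

definition padic_haar :: "nat \<Rightarrow> (nat \<Rightarrow> int) measure" where
  "padic_haar p = (THE M. is_padic_haar p M)"


section \<open>Functions on the p-adic integers\<close>

definition padic_one_lipschitz :: "nat \<Rightarrow> ((nat \<Rightarrow> int) \<Rightarrow> (nat \<Rightarrow> int)) \<Rightarrow> bool" where
  "padic_one_lipschitz p f \<longleftrightarrow>
    (\<forall>x\<in>carrier (Zp p). \<forall>y\<in>carrier (Zp p).
      padic_abs p (f x \<ominus>\<^bsub>Zp p\<^esub> f y) \<le> padic_abs p (x \<ominus>\<^bsub>Zp p\<^esub> y))"

definition padic_measure_preserving :: "nat \<Rightarrow> ((nat \<Rightarrow> int) \<Rightarrow> (nat \<Rightarrow> int)) \<Rightarrow> bool" where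
  "padic_measure_preserving p f \<longleftrightarrow>
    f \<in> measurable (padic_haar p) (padic_haar p) \<and>
    (\<forall>S\<in>sets (padic_haar p).
      emeasure (padic_haar p) (f -` S \<inter> carrier (Zp p)) = emeasure (padic_haar p) S)"

definition floor_log_base :: "nat \<Rightarrow> nat \<Rightarrow> nat" where
  "floor_log_base p m = nat \<lfloor>log (real p) (real m)\<rfloor>"

text \<open>\<open>m div p ^ s mod p\<close> is the base-\<open>p\<close> digit of \<open>m\<close> at position \<open>s\<close>.\<close>

definition leading_term :: "nat \<Rightarrow> nat \<Rightarrow> nat" where
  "leading_term p m = (let s = floor_log_base p m in (m div p ^ s mod p) * p ^ s)"

definition van_der_Put :: "nat \<Rightarrow> nat \<Rightarrow> (nat \<Rightarrow> int) \<Rightarrow> (nat \<Rightarrow> int)" where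
  "van_der_Put p m x =
    (if padic_abs p (x \<ominus>\<^bsub>Zp p\<^esub> padic_of_nat p m)
        \<le> (if m = 0 then 1 / real p else 1 / real p ^ (floor_log_base p m + 1))
     then \<one>\<^bsub>Zp p\<^esub> else \<zero>\<^bsub>Zp p\<^esub>)"

definition van_der_Put_expansion ::
    "nat \<Rightarrow> ((nat \<Rightarrow> int) \<Rightarrow> (nat \<Rightarrow> int)) \<Rightarrow> (nat \<Rightarrow> nat \<Rightarrow> int) \<Rightarrow> bool" where
  "van_der_Put_expansion p f B \<longleftrightarrow>
    (\<forall>m. B m \<in> carrier (Zp p)) \<and>
    (\<forall>x\<in>carrier (Zp p).
      limitin (padic_topology p)
        (\<lambda>N. \<Oplus>\<^bsub>Zp p\<^esub>m\<in>{..<N}. B m \<otimes>\<^bsub>Zp p\<^esub> van_der_Put p m x) (f x) sequentially)"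


section \<open>Basic facts\<close>

lemma Zp_carrier_iff:
  "x \<in> carrier (Zp p) \<longleftrightarrow> (\<forall>n. 0 \<le> x n \<and> x n < int p ^ n \<and> x (Suc n) mod int p ^ n = x n)"
  by (auto simp: Zp_def)

lemma Zp_mult: "x \<otimes>\<^bsub>Zp p\<^esub> y = (\<lambda>n. x n * y n mod int p ^ n)"
  and Zp_add: "x \<oplus>\<^bsub>Zp p\<^esub> y = (\<lambda>n. (x n + y n) mod int p ^ n)"
  and Zp_one: "\<one>\<^bsub>Zp p\<^esub> = (\<lambda>n. 1 mod int p ^ n)"
  and Zp_zero: "\<zero>\<^bsub>Zp p\<^esub> = (\<lambda>n. 0)"
  by (simp_all add: Zp_def)

lemma mod_pow_Suc: "(a::int) mod q ^ Suc n mod q ^ n = a mod q ^ n"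
  by (rule mod_mod_cancel) simp

lemma Zp_mod:
  assumes "x \<in> carrier (Zp p)" "n \<le> m"
  shows "x m mod int p ^ n = x n"
  using assms(2)
proof (induction m rule: dec_induct)
  case base
  then show ?case using assms(1) by (simp add: Zp_carrier_iff)
next
  case (step m)
  have "x (Suc m) mod int p ^ n = x (Suc m) mod int p ^ m mod int p ^ n"
    using step.hyps by (intro mod_mod_cancel [symmetric] le_imp_power_dvd) auto
  also have "x (Suc m) mod int p ^ m = x m"
    using assms(1) by (simp add: Zp_carrier_iff)
  finally show ?case using step.IH by simp
qed

lemma Zp_mod_self: "x \<in> carrier (Zp p) \<Longrightarrow> x n mod int p ^ n = x n"
  by (rule Zp_mod) auto

lemma Zp_reduceI:
  assumes "p > 0" "\<And>n. a (Suc n) mod int p ^ n = a n mod int p ^ n"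
  shows "(\<lambda>n. a n mod int p ^ n) \<in> carrier (Zp p)"
  using assms by (simp add: Zp_carrier_iff mod_pow_Suc del: power_Suc)

context
  fixes p :: nat
  assumes p: "prime p"
begin

lemma p_pos: "p > 0" and p_gt_1: "p > 1"
  using p prime_gt_0_nat prime_gt_1_nat by auto

lemma Zp_closed:
  assumes "x \<in> carrier (Zp p)" "y \<in> carrier (Zp p)"
  shows "x \<oplus>\<^bsub>Zp p\<^esub> y \<in> carrier (Zp p)" "x \<otimes>\<^bsub>Zp p\<^esub> y \<in> carrier (Zp p)"
    "(\<lambda>n. (- x n) mod int p ^ n) \<in> carrier (Zp p)"
proof -
  have x: "x (Suc n) mod int p ^ n = x n mod int p ^ n"
    and y: "y (Suc n) mod int p ^ n = y n mod int p ^ n" for n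
    using assms by (auto simp: Zp_mod Zp_mod_self)
  show "x \<oplus>\<^bsub>Zp p\<^esub> y \<in> carrier (Zp p)"
    unfolding Zp_add by (intro Zp_reduceI p_pos mod_add_cong x y)
  show "x \<otimes>\<^bsub>Zp p\<^esub> y \<in> carrier (Zp p)"
    unfolding Zp_mult by (intro Zp_reduceI p_pos mod_mult_cong x y)
  show "(\<lambda>n. (- x n) mod int p ^ n) \<in> carrier (Zp p)"
    by (intro Zp_reduceI p_pos mod_minus_cong x)
qed

lemma Zp_zero_one: "\<zero>\<^bsub>Zp p\<^esub> \<in> carrier (Zp p)" "\<one>\<^bsub>Zp p\<^esub> \<in> carrier (Zp p)"
proof -
  show "\<zero>\<^bsub>Zp p\<^esub> \<in> carrier (Zp p)" using p_pos by (simp add: Zp_zero Zp_carrier_iff)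
  show "\<one>\<^bsub>Zp p\<^esub> \<in> carrier (Zp p)" unfolding Zp_one by (rule Zp_reduceI) (auto intro: p_pos)
qed

lemma cring_Zp: "cring (Zp p)"
proof (rule cringI)
  show "abelian_group (Zp p)"
  proof (rule abelian_groupI)
    fix x assume x: "x \<in> carrier (Zp p)"
    show "\<exists>y\<in>carrier (Zp p). y \<oplus>\<^bsub>Zp p\<^esub> x = \<zero>\<^bsub>Zp p\<^esub>"
      by (rule bexI[OF _ Zp_closed(3)[OF x x]]) (auto simp: Zp_add Zp_zero mod_simps)
    show "\<zero>\<^bsub>Zp p\<^esub> \<oplus>\<^bsub>Zp p\<^esub> x = x"
      using x by (simp add: Zp_add Zp_zero Zp_mod_self)
  qed (auto simp: Zp_closed Zp_zero_one, auto simp: Zp_add mod_simps algebra_simps)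
  show "comm_monoid (Zp p)"
  proof (rule comm_monoidI)
    fix x assume x: "x \<in> carrier (Zp p)"
    show "\<one>\<^bsub>Zp p\<^esub> \<otimes>\<^bsub>Zp p\<^esub> x = x"
      using x by (simp add: Zp_mult Zp_one Zp_mod_self mod_simps)
  qed (auto simp: Zp_closed Zp_zero_one, auto simp: Zp_mult mod_simps algebra_simps)
qed (auto simp: Zp_add Zp_mult mod_simps algebra_simps)

interpretation Zp: cring "Zp p" by (rule cring_Zp)

lemma Zp_uminus:
  assumes "x \<in> carrier (Zp p)"
  shows "\<ominus>\<^bsub>Zp p\<^esub> x = (\<lambda>n. (- x n) mod int p ^ n)"
  by (rule Zp.minus_equality) (use assms in \<open>auto simp: Zp_closed Zp_add Zp_zero mod_simps\<close>)

lemma Zp_minus: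
  assumes "x \<in> carrier (Zp p)" "y \<in> carrier (Zp p)"
  shows "(x \<ominus>\<^bsub>Zp p\<^esub> y) n = (x n - y n) mod int p ^ n"
  using assms by (simp add: a_minus_def Zp_uminus Zp_add mod_simps)

lemma Zp_minus_eq_0_iff:
  assumes "x \<in> carrier (Zp p)" "y \<in> carrier (Zp p)"
  shows "(x \<ominus>\<^bsub>Zp p\<^esub> y) n = 0 \<longleftrightarrow> x n = y n"
proof -
  have "(x n - y n) mod int p ^ n = 0 \<longleftrightarrow> x n mod int p ^ n = y n mod int p ^ n"
    by (simp add: mod_eq_dvd_iff mod_eq_0_iff_dvd)
  then show ?thesis using assms by (simp add: Zp_minus Zp_mod_self)
qed

lemma Zp_add_minus:
  assumes "x \<in> carrier (Zp p)" "a \<in> carrier (Zp p)"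
  shows "a \<oplus>\<^bsub>Zp p\<^esub> (x \<ominus>\<^bsub>Zp p\<^esub> a) = x" "a \<oplus>\<^bsub>Zp p\<^esub> x \<ominus>\<^bsub>Zp p\<^esub> a = x"
proof -
  show "a \<oplus>\<^bsub>Zp p\<^esub> (x \<ominus>\<^bsub>Zp p\<^esub> a) = x"
    by (rule ext) (use assms in \<open>simp add: Zp_add Zp_minus mod_simps Zp_mod_self\<close>)
  have "(a \<oplus>\<^bsub>Zp p\<^esub> x \<ominus>\<^bsub>Zp p\<^esub> a) n = x n" for n
  proof -
    have "(a \<oplus>\<^bsub>Zp p\<^esub> x \<ominus>\<^bsub>Zp p\<^esub> a) n = ((a \<oplus>\<^bsub>Zp p\<^esub> x) n - a n) mod int p ^ n"
      using assms by (intro Zp_minus) auto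
    also have "\<dots> = x n" using assms by (simp add: Zp_add mod_simps Zp_mod_self)
    finally show ?thesis .
  qed
  then show "a \<oplus>\<^bsub>Zp p\<^esub> x \<ominus>\<^bsub>Zp p\<^esub> a = x" by auto
qed

lemma Zp_minus_eq_zero_iff:
  assumes "x \<in> carrier (Zp p)" "y \<in> carrier (Zp p)"
  shows "x \<ominus>\<^bsub>Zp p\<^esub> y = \<zero>\<^bsub>Zp p\<^esub> \<longleftrightarrow> x = y"
  using Zp_minus_eq_0_iff[OF assms] by (auto simp: fun_eq_iff Zp_zero)

lemma padic_of_nat_closed: "padic_of_nat p m \<in> carrier (Zp p)"
  by simp

lemma padic_of_nat_nth: "padic_of_nat p m n = int m mod int p ^ n"
  by (induction m) (simp_all add: Zp.add.nat_pow_Suc Zp_zero Zp_add Zp_one mod_simps add.commute)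

lemma padic_pow_ideal_iff: "x \<in> padic_pow_ideal p n \<longleftrightarrow> x \<in> carrier (Zp p) \<and> x n = 0"
proof
  assume "x \<in> padic_pow_ideal p n"
  then obtain z where z: "z \<in> carrier (Zp p)" "x = z \<otimes>\<^bsub>Zp p\<^esub> padic_of_nat p (p ^ n)"
    unfolding padic_pow_ideal_def cgenideal_def by auto
  moreover from z have "x \<in> carrier (Zp p)" by simp
  moreover from z have "x n = 0" by (simp add: Zp_mult padic_of_nat_nth)
  ultimately show "x \<in> carrier (Zp p) \<and> x n = 0" by simp
next
  assume x: "x \<in> carrier (Zp p) \<and> x n = 0"
  define z where "z = (\<lambda>k. x (n + k) div int p ^ n)"
  have dvd: "int p ^ n dvd x (n + k)" for k
    using Zp_mod[of x p n "n + k"] x by (simp add: mod_eq_0_iff_dvd)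
  have "z \<in> carrier (Zp p)"
    unfolding Zp_carrier_iff
  proof (intro allI conjI)
    fix k
    have b: "0 \<le> x (n + k)" "x (n + k) < int p ^ n * int p ^ k"
      using conjunct1[OF x, unfolded Zp_carrier_iff, rule_format, of "n + k"]
      by (simp_all add: power_add)
    show "0 \<le> z k" using b by (simp add: z_def pos_imp_zdiv_nonneg_iff p_pos)
    have "int p ^ n * z k < int p ^ n * int p ^ k" using b dvd by (simp add: z_def)
    then show "z k < int p ^ k" using p_pos by simp
    have "int p ^ n * (z (Suc k) mod int p ^ k) = (int p ^ n * z (Suc k)) mod int p ^ (n + k)"
      by (simp only: power_add mult_mod_right)
    also have "int p ^ n * z (Suc k) = x (n + Suc k)"
      unfolding z_def using dvd[of "Suc k"] by (rule dvd_mult_div_cancel)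
    also have "x (n + Suc k) mod int p ^ (n + k) = x (n + k)"
      using x by (intro Zp_mod) auto
    also have "\<dots> = int p ^ n * z k"
      using dvd by (simp add: z_def)
    finally show "z (Suc k) mod int p ^ k = z k" using p_pos by simp
  qed
  moreover have "x = z \<otimes>\<^bsub>Zp p\<^esub> padic_of_nat p (p ^ n)"
  proof
    fix k
    have "(z \<otimes>\<^bsub>Zp p\<^esub> padic_of_nat p (p ^ n)) k = x (n + k) mod int p ^ k"
      using dvd_div_mult_self[OF dvd[of k]]
      by (simp add: Zp_mult padic_of_nat_nth mod_mult_right_eq z_def)
    also have "\<dots> = x k" using x by (intro Zp_mod) auto
    finally show "x k = (z \<otimes>\<^bsub>Zp p\<^esub> padic_of_nat p (p ^ n)) k" by simp
  qed
  ultimately show "x \<in> padic_pow_ideal p n"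
    unfolding padic_pow_ideal_def cgenideal_def by auto
qed

lemma padic_cong_iff:
  assumes "x \<in> carrier (Zp p)" "y \<in> carrier (Zp p)"
  shows "padic_cong p n x y \<longleftrightarrow> x n = y n"
  using assms by (simp add: padic_cong_def padic_pow_ideal_iff Zp_minus_eq_0_iff)

lemma Zp_zero_down:
  assumes "x \<in> carrier (Zp p)" "x m = 0" "n \<le> m"
  shows "x n = 0"
  using Zp_mod[OF assms(1,3)] assms(2) by simp

lemma padic_ord_iff:
  assumes "x \<in> carrier (Zp p)" "x \<noteq> \<zero>\<^bsub>Zp p\<^esub>"
  shows "n \<le> padic_ord p x \<longleftrightarrow> x n = 0"
proof -
  obtain N where N: "x N \<noteq> 0" using assms(2) by (auto simp: Zp_zero)
  have bd: "m \<le> N" if "x \<in> padic_pow_ideal p m" for m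
    using that N Zp_zero_down[OF assms(1), of m N] by (force simp: padic_pow_ideal_iff)
  have "x \<in> padic_pow_ideal p 0"
    using assms(1) Zp_carrier_iff[of x p] by (auto simp: padic_pow_ideal_iff dest: spec[of _ 0])
  then have "x \<in> padic_pow_ideal p (padic_ord p x)"
    unfolding padic_ord_def by (rule GreatestI_nat) (use bd in auto)
  moreover have "m \<le> padic_ord p x" if "x \<in> padic_pow_ideal p m" for m
    unfolding padic_ord_def using that by (rule Greatest_le_nat) (use bd in auto)
  ultimately show ?thesis
    using assms(1) Zp_zero_down[OF assms(1), of "padic_ord p x" n]
    by (auto simp: padic_pow_ideal_iff)
qed

lemma padic_abs_le_iff:
  assumes "x \<in> carrier (Zp p)"
  shows "padic_abs p x \<le> 1 / real p ^ n \<longleftrightarrow> x n = 0"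
proof (cases "x = \<zero>\<^bsub>Zp p\<^esub>")
  case True
  then show ?thesis by (simp add: padic_abs_def Zp_zero)
next
  case False
  have "1 / real p ^ padic_ord p x \<le> 1 / real p ^ n \<longleftrightarrow> n \<le> padic_ord p x"
    using p_gt_1 by (simp add: divide_simps)
  then show ?thesis using False assms by (simp add: padic_abs_def padic_ord_iff)
qed

lemma padic_abs_nonneg: "0 \<le> padic_abs p x"
  by (simp add: padic_abs_def)

lemma padic_abs_eq_0_iff: "padic_abs p x = 0 \<longleftrightarrow> x = \<zero>\<^bsub>Zp p\<^esub>"
  using p_pos by (simp add: padic_abs_def)

lemma padic_abs_cases:
  obtains "x = \<zero>\<^bsub>Zp p\<^esub>" "padic_abs p x = 0" | n where "padic_abs p x = 1 / real p ^ n"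
  by (cases "x = \<zero>\<^bsub>Zp p\<^esub>") (auto simp: padic_abs_def)

lemma padic_dist_le_iff:
  assumes "x \<in> carrier (Zp p)" "y \<in> carrier (Zp p)"
  shows "padic_dist p x y \<le> 1 / real p ^ n \<longleftrightarrow> x n = y n"
  using assms by (simp add: padic_dist_def padic_abs_le_iff Zp_minus_eq_0_iff)

lemma padic_dist_ultra:
  assumes "x \<in> carrier (Zp p)" "y \<in> carrier (Zp p)" "z \<in> carrier (Zp p)"
  shows "padic_dist p x z \<le> max (padic_dist p x y) (padic_dist p y z)"
proof -
  define d where "d = max (padic_dist p x y) (padic_dist p y z)"
  have le: "padic_dist p x y \<le> d" "padic_dist p y z \<le> d" by (auto simp: d_def)
  have "d = padic_abs p (x \<ominus>\<^bsub>Zp p\<^esub> y) \<or> d = padic_abs p (y \<ominus>\<^bsub>Zp p\<^esub> z)"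
    using assms unfolding d_def padic_dist_def by (simp add: max_def)
  then have "d = 0 \<or> (\<exists>n. d = 1 / real p ^ n)"
    by (metis padic_abs_def)
  then show ?thesis
  proof
    assume "d = 0"
    then have "x \<ominus>\<^bsub>Zp p\<^esub> y = \<zero>\<^bsub>Zp p\<^esub>" "y \<ominus>\<^bsub>Zp p\<^esub> z = \<zero>\<^bsub>Zp p\<^esub>"
      using le assms padic_abs_nonneg
      by (auto simp: padic_dist_def padic_abs_eq_0_iff[symmetric] intro: antisym)
    then have "x = y" "y = z" using assms by (simp_all add: Zp_minus_eq_zero_iff)
    then show ?thesis by simp
  next
    assume "\<exists>n. d = 1 / real p ^ n"
    then obtain n where "d = 1 / real p ^ n" by auto
    then show ?thesis using le assms unfolding d_def[symmetric] by (simp add: padic_dist_le_iff)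
  qed
qed

lemma padic_dist_commute: "padic_dist p x y = padic_dist p y x"
proof (cases "x \<in> carrier (Zp p) \<and> y \<in> carrier (Zp p)")
  case True
  have le: "padic_dist p a b \<le> padic_dist p b a"
    if ab: "a \<in> carrier (Zp p)" "b \<in> carrier (Zp p)" for a b
  proof (cases rule: padic_abs_cases[of "b \<ominus>\<^bsub>Zp p\<^esub> a"])
    case 1
    then have "a = b" using ab by (simp add: Zp_minus_eq_zero_iff)
    then show ?thesis by simp
  next
    case (2 n)
    then have "padic_dist p b a = 1 / real p ^ n" using ab by (simp add: padic_dist_def)
    then show ?thesis using padic_dist_le_iff[OF ab] padic_dist_le_iff[OF ab(2,1), of n] by auto
  qed
  show ?thesis using le True by (intro antisym) auto
qed (auto simp: padic_dist_def)

lemma Metric_space_Zp: "Metric_space (carrier (Zp p)) (padic_dist p)"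
proof
  fix x y z
  show ge: "0 \<le> padic_dist p x y" for x y by (simp add: padic_dist_def padic_abs_nonneg)
  show "padic_dist p x y = padic_dist p y x" by (rule padic_dist_commute)
  assume x: "x \<in> carrier (Zp p)" and y: "y \<in> carrier (Zp p)"
  show "padic_dist p x y = 0 \<longleftrightarrow> x = y"
    using x y by (simp add: padic_dist_def padic_abs_eq_0_iff Zp_minus_eq_zero_iff)
  assume z: "z \<in> carrier (Zp p)"
  show "padic_dist p x z \<le> padic_dist p x y + padic_dist p y z"
    using padic_dist_ultra[OF x y z] ge[of x y] ge[of y z] by linarith
qed

end

definition padic_cyl :: "nat \<Rightarrow> nat \<Rightarrow> int \<Rightarrow> (nat \<Rightarrow> int) set" where
  "padic_cyl p n c = {x \<in> carrier (Zp p). x n = c}"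

definition padic_cyls :: "nat \<Rightarrow> (nat \<Rightarrow> int) set set" where
  "padic_cyls p = (\<Union>n. range (padic_cyl p n))"

lemma padic_cyls_Pow: "padic_cyls p \<subseteq> Pow (carrier (Zp p))"
  by (auto simp: padic_cyls_def padic_cyl_def)

lemma padic_cyl_outside: "c \<notin> {0..<int p ^ n} \<Longrightarrow> padic_cyl p n c = {}"
  by (auto simp: padic_cyl_def Zp_carrier_iff)

lemma Int_stable_padic_cyls: "Int_stable (padic_cyls p)"
proof -
  have *: "padic_cyl p n c \<inter> padic_cyl p m d \<in> padic_cyls p" if "n \<le> m" for n m c d
  proof (cases "d mod int p ^ n = c")
    case True
    then have "padic_cyl p n c \<inter> padic_cyl p m d = padic_cyl p m d"
      using that by (auto simp: padic_cyl_def Zp_mod)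
    then show ?thesis by (auto simp: padic_cyls_def)
  next
    case False
    then have "padic_cyl p n c \<inter> padic_cyl p m d = padic_cyl p 0 (-1)"
      using that padic_cyl_outside[of "-1" p 0] by (auto simp: padic_cyl_def Zp_mod)
    then show ?thesis by (auto simp: padic_cyls_def)
  qed
  show ?thesis
  proof (rule Int_stableI)
    fix a b assume "a \<in> padic_cyls p" "b \<in> padic_cyls p"
    then obtain n c m d where ab: "a = padic_cyl p n c" "b = padic_cyl p m d"
      by (auto simp: padic_cyls_def)
    show "a \<inter> b \<in> padic_cyls p"
      using *[of n m c d] *[of m n d c] unfolding ab by (cases "n \<le> m") (auto simp: Int_commute)
  qed
qed

lemma padic_cyl_0: "padic_cyl p 0 0 = carrier (Zp p)"
proof -
  have "x 0 = 0" if "x \<in> carrier (Zp p)" for x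
  proof -
    have "0 \<le> x 0 \<and> x 0 < int p ^ 0" using that unfolding Zp_carrier_iff by blast
    then show ?thesis by simp
  qed
  then show ?thesis by (auto simp: padic_cyl_def)
qed

context
  fixes p :: nat
  assumes p: "prime p"
begin

interpretation Zp: cring "Zp p" by (rule cring_Zp[OF p])
interpretation ZpM: Metric_space "carrier (Zp p)" "padic_dist p" by (rule Metric_space_Zp[OF p])

lemma openin_padic_iff:
  "openin (padic_topology p) U \<longleftrightarrow>
    U \<subseteq> carrier (Zp p) \<and> (\<forall>x\<in>U. \<exists>n. padic_cyl p n (x n) \<subseteq> U)"
proof -
  have "(\<exists>r>0. ZpM.mcball x r \<subseteq> U) \<longleftrightarrow> (\<exists>n. padic_cyl p n (x n) \<subseteq> U)"
    if x: "x \<in> carrier (Zp p)" for x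
  proof -
    have eq: "ZpM.mcball x (1 / real p ^ n) = padic_cyl p n (x n)" for n
      using x by (auto simp: ZpM.mcball_def padic_cyl_def padic_dist_le_iff[OF p])
    show ?thesis
    proof
      assume "\<exists>r>0. ZpM.mcball x r \<subseteq> U"
      then obtain r where r: "r > 0" "ZpM.mcball x r \<subseteq> U" by auto
      obtain n where "(1 / real p) ^ n < r"
        using real_arch_pow_inv[OF r(1), of "1 / real p"] p_gt_1[OF p] by auto
      then have "ZpM.mcball x (1 / real p ^ n) \<subseteq> ZpM.mcball x r"
        by (intro ZpM.mcball_subset_concentric) (simp add: power_divide)
      then show "\<exists>n. padic_cyl p n (x n) \<subseteq> U" using r eq by blast
    next
      assume "\<exists>n. padic_cyl p n (x n) \<subseteq> U"
      then obtain n where "padic_cyl p n (x n) \<subseteq> U" by auto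
      then show "\<exists>r>0. ZpM.mcball x r \<subseteq> U"
        using p_pos[OF p] by (intro exI[of _ "1 / real p ^ n"]) (simp add: eq)
    qed
  qed
  then show ?thesis
    unfolding padic_topology_def ZpM.openin_mtopology_mcball by blast
qed

lemma openin_padic_cyl: "openin (padic_topology p) (padic_cyl p n c)"
  unfolding openin_padic_iff by (auto simp: padic_cyl_def intro!: exI[of _ n])

lemma space_padic_borel: "space (padic_borel p) = carrier (Zp p)"
  unfolding padic_borel_def by (rule space_measure_of) (auto simp: openin_padic_iff)

lemma sets_padic_borel: "sets (padic_borel p) = sigma_sets (carrier (Zp p)) (padic_cyls p)"
proof -
  have "sets (padic_borel p) = sigma_sets (carrier (Zp p)) {U. openin (padic_topology p) U}"
    unfolding padic_borel_def by (rule sets_measure_of) (auto simp: openin_padic_iff)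
  also have "\<dots> = sigma_sets (carrier (Zp p)) (padic_cyls p)"
  proof (rule sigma_sets_eqI)
    fix U assume "U \<in> {U. openin (padic_topology p) U}"
    then have U: "U \<subseteq> carrier (Zp p)" "\<forall>x\<in>U. \<exists>n. padic_cyl p n (x n) \<subseteq> U"
      by (auto simp: openin_padic_iff)
    define I where "I = {(n, c). padic_cyl p n c \<subseteq> U}"
    have "U = (\<Union>i\<in>I. padic_cyl p (fst i) (snd i))"
    proof (intro equalityI subsetI)
      fix x assume x: "x \<in> U"
      then obtain n where "padic_cyl p n (x n) \<subseteq> U" using U by auto
      moreover have "x \<in> padic_cyl p n (x n)" using x U by (auto simp: padic_cyl_def)
      ultimately show "x \<in> (\<Union>i\<in>I. padic_cyl p (fst i) (snd i))"
        by (intro UN_I[of "(n, x n)"]) (auto simp: I_def)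
    qed (auto simp: I_def)
    moreover have "(\<Union>i\<in>I. padic_cyl p (fst i) (snd i)) \<in>
        sigma_sets (carrier (Zp p)) (padic_cyls p)"
    proof -
      interpret S: sigma_algebra "carrier (Zp p)" "sigma_sets (carrier (Zp p)) (padic_cyls p)"
        by (rule sigma_algebra_sigma_sets[OF padic_cyls_Pow])
      show ?thesis
        by (intro S.countable_UN') (auto intro!: sigma_sets.Basic simp: padic_cyls_def)
    qed
    ultimately show "U \<in> sigma_sets (carrier (Zp p)) (padic_cyls p)" by simp
  next
    fix C assume "C \<in> padic_cyls p"
    then show "C \<in> sigma_sets (carrier (Zp p)) {U. openin (padic_topology p) U}"
      by (auto simp: padic_cyls_def intro!: sigma_sets.Basic openin_padic_cyl)
  qed
  finally show ?thesis .
qed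

lemma padic_cyl_sets: "padic_cyl p n c \<in> sets (padic_borel p)"
  unfolding sets_padic_borel by (auto intro!: sigma_sets.Basic simp: padic_cyls_def)

lemma measure_eqI_cyl:
  assumes "sets M = sets (padic_borel p)" "sets N = sets (padic_borel p)"
    and "\<And>n c. c \<in> {0..<int p ^ n} \<Longrightarrow> emeasure M (padic_cyl p n c) = emeasure N (padic_cyl p n c)"
    and "emeasure M (carrier (Zp p)) \<noteq> \<infinity>"
  shows "M = N"
proof (rule measure_eqI_generator_eq[OF Int_stable_padic_cyls padic_cyls_Pow])
  show "sets M = sigma_sets (carrier (Zp p)) (padic_cyls p)"
    "sets N = sigma_sets (carrier (Zp p)) (padic_cyls p)"
    using assms by (auto simp: sets_padic_borel)
  fix X assume "X \<in> padic_cyls p"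
  then obtain n c where X: "X = padic_cyl p n c" by (auto simp: padic_cyls_def)
  show "emeasure M X = emeasure N X"
    unfolding X using assms(3)[of c n] padic_cyl_outside[of c p n]
    by (cases "c \<in> {0..<int p ^ n}") auto
next
  show "range (\<lambda>i::nat. carrier (Zp p)) \<subseteq> padic_cyls p"
    using padic_cyl_0[of p] by (auto simp: padic_cyls_def)
  show "(\<Union>i::nat. carrier (Zp p)) = carrier (Zp p)" by simp
  show "emeasure M (carrier (Zp p)) \<noteq> \<infinity>" by fact
qed

lemma translate_cyl:
  assumes a: "a \<in> carrier (Zp p)" and c: "c \<in> {0..<int p ^ n}"
  shows "a <+\<^bsub>Zp p\<^esub> padic_cyl p n c = padic_cyl p n ((a n + c) mod int p ^ n)"
proof (intro equalityI subsetI)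
  fix x assume "x \<in> a <+\<^bsub>Zp p\<^esub> padic_cyl p n c"
  then obtain y where "y \<in> padic_cyl p n c" "x = a \<oplus>\<^bsub>Zp p\<^esub> y"
    by (auto simp: a_l_coset_def l_coset_def)
  then show "x \<in> padic_cyl p n ((a n + c) mod int p ^ n)"
    using Zp_closed(1)[OF p a, of y] by (auto simp: padic_cyl_def Zp_add)
next
  fix x assume x: "x \<in> padic_cyl p n ((a n + c) mod int p ^ n)"
  then have xc: "x \<in> carrier (Zp p)" by (simp add: padic_cyl_def)
  have "x \<ominus>\<^bsub>Zp p\<^esub> a \<in> padic_cyl p n c"
    using x xc a c by (auto simp: padic_cyl_def Zp_minus[OF p] mod_simps)
  moreover have "x = a \<oplus>\<^bsub>Zp p\<^esub> (x \<ominus>\<^bsub>Zp p\<^esub> a)"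
    using xc a by (simp add: Zp_add_minus[OF p])
  ultimately show "x \<in> a <+\<^bsub>Zp p\<^esub> padic_cyl p n c"
    by (auto simp: a_l_coset_def l_coset_def)
qed

lemma translate_vimage:
  assumes a: "a \<in> carrier (Zp p)" and S: "S \<subseteq> carrier (Zp p)"
  shows "a <+\<^bsub>Zp p\<^esub> S = (\<lambda>x. x \<ominus>\<^bsub>Zp p\<^esub> a) -` S \<inter> carrier (Zp p)"
proof (intro equalityI subsetI)
  fix x assume "x \<in> a <+\<^bsub>Zp p\<^esub> S"
  then obtain y where y: "y \<in> S" "x = a \<oplus>\<^bsub>Zp p\<^esub> y"
    by (auto simp: a_l_coset_def l_coset_def)
  moreover have "a \<oplus>\<^bsub>Zp p\<^esub> y \<ominus>\<^bsub>Zp p\<^esub> a = y"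
    using a y S by (auto simp: Zp_add_minus[OF p])
  ultimately show "x \<in> (\<lambda>x. x \<ominus>\<^bsub>Zp p\<^esub> a) -` S \<inter> carrier (Zp p)" using a S by auto
next
  fix x assume x: "x \<in> (\<lambda>x. x \<ominus>\<^bsub>Zp p\<^esub> a) -` S \<inter> carrier (Zp p)"
  then have "x = a \<oplus>\<^bsub>Zp p\<^esub> (x \<ominus>\<^bsub>Zp p\<^esub> a)"
    using a by (simp add: Zp_add_minus[OF p])
  then show "x \<in> a <+\<^bsub>Zp p\<^esub> S" using x by (auto simp: a_l_coset_def l_coset_def)
qed

lemma is_padic_haar_cyl:
  assumes M: "is_padic_haar p M" and c: "c \<in> {0..<int p ^ n}"
  shows "emeasure M (padic_cyl p n c) = ennreal (1 / real p ^ n)"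
proof -
  have s: "sets M = sets (padic_borel p)" and one: "emeasure M (carrier (Zp p)) = 1"
    and tr: "\<And>a S. a \<in> carrier (Zp p) \<Longrightarrow> S \<in> sets M \<Longrightarrow>
      emeasure M (a <+\<^bsub>Zp p\<^esub> S) = emeasure M S"
    using M by (auto simp: is_padic_haar_def)
  have eq: "emeasure M (padic_cyl p n d) = emeasure M (padic_cyl p n 0)"
    if d: "d \<in> {0..<int p ^ n}" for d
  proof -
    have "padic_of_nat p (nat d) <+\<^bsub>Zp p\<^esub> padic_cyl p n 0 = padic_cyl p n d"
      using d p_pos[OF p]
      by (subst translate_cyl) (auto simp: padic_of_nat_nth[OF p])
    then show ?thesis
      using tr[of "padic_of_nat p (nat d)" "padic_cyl p n 0"] s padic_cyl_sets by simp
  qed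
  have "carrier (Zp p) = (\<Union>d\<in>{0..<int p ^ n}. padic_cyl p n d)"
    by (auto simp: padic_cyl_def Zp_carrier_iff)
  then have "1 = emeasure M (\<Union>d\<in>{0..<int p ^ n}. padic_cyl p n d)" using one by simp
  also have "\<dots> = (\<Sum>d\<in>{0..<int p ^ n}. emeasure M (padic_cyl p n d))"
  proof (rule sum_emeasure[symmetric])
    show "padic_cyl p n ` {0..<int p ^ n} \<subseteq> sets M" using s padic_cyl_sets by auto
    show "disjoint_family_on (padic_cyl p n) {0..<int p ^ n}"
      by (auto simp: disjoint_family_on_def padic_cyl_def)
  qed simp
  also have "\<dots> = of_nat (p ^ n) * emeasure M (padic_cyl p n 0)"
    by (simp add: eq nat_power_eq)
  finally have *: "of_nat (p ^ n) * emeasure M (padic_cyl p n 0) = 1" by simp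
  have fin: "emeasure M (padic_cyl p n 0) \<noteq> \<infinity>"
    using * p_pos[OF p] by (auto simp: ennreal_mult_top)
  then obtain r where r: "emeasure M (padic_cyl p n 0) = ennreal r" "r \<ge> 0"
    by (cases "emeasure M (padic_cyl p n 0)") auto
  have "ennreal (real (p ^ n) * r) = ennreal 1"
    using * r by (simp add: ennreal_mult ennreal_of_nat_eq_real_of_nat del: of_nat_power)
  then have "real p ^ n * r = 1" using r(2) by (subst (asm) ennreal_inj) auto
  then have "r = 1 / real p ^ n" using p_pos[OF p] by (simp add: field_simps)
  then show ?thesis using eq[OF c] r by simp
qed

lemma is_padic_haar_unique:
  assumes "is_padic_haar p M" "is_padic_haar p N"
  shows "M = N"
  using assms is_padic_haar_cyl[OF assms(1)] is_padic_haar_cyl[OF assms(2)]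
  by (intro measure_eqI_cyl) (auto simp: is_padic_haar_def)

text \<open>Existence: the image of the uniform product measure on sequences of digits.\<close>

definition digit_sum :: "(nat \<Rightarrow> int) \<Rightarrow> nat \<Rightarrow> int" where
  "digit_sum d n = (\<Sum>i<n. d i * int p ^ i)"

definition digit_measure :: "(nat \<Rightarrow> int) measure" where
  "digit_measure = PiM UNIV (\<lambda>_. uniform_count_measure {0..<int p})"

lemma prob_space_digit: "prob_space (uniform_count_measure {0..<int p})"
  using p_pos[OF p] by (intro prob_space_uniform_count_measure) auto

lemma space_digit_measure: "space digit_measure = {d. \<forall>i. d i \<in> {0..<int p}}"
  by (auto simp: digit_measure_def space_PiM PiE_def Pi_def space_uniform_count_measure)

lemma digit_sum_bounds:
  assumes "\<forall>i. d i \<in> {0..<int p}"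
  shows "digit_sum d n \<in> {0..<int p ^ n}"
proof (induction n)
  case 0
  then show ?case by (simp add: digit_sum_def)
next
  case (Suc n)
  have d: "0 \<le> d n" "d n \<le> int p - 1" using assms by (auto dest: spec[of _ n])
  then have "d n * int p ^ n \<le> (int p - 1) * int p ^ n" by (intro mult_right_mono) auto
  moreover have "0 \<le> d n * int p ^ n" using d by simp
  ultimately show ?case using Suc by (simp add: digit_sum_def algebra_simps)
qed

lemma digit_sum_Suc: "digit_sum d (Suc n) = digit_sum d n + d n * int p ^ n"
  by (simp add: digit_sum_def)

lemma digit_sum_Zp:
  assumes "\<forall>i. d i \<in> {0..<int p}"
  shows "digit_sum d \<in> carrier (Zp p)"
  unfolding Zp_carrier_iff using digit_sum_bounds[OF assms] by (auto simp: digit_sum_Suc)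

lemma digit_sum_eq_iff:
  assumes "\<forall>i. d i \<in> {0..<int p}" "c \<in> {0..<int p ^ n}"
  shows "digit_sum d n = c \<longleftrightarrow> (\<forall>i<n. d i = c div int p ^ i mod int p)"
  using assms(2)
proof (induction n arbitrary: c)
  case 0
  then show ?case by (simp add: digit_sum_def)
next
  case (Suc n)
  define P where "P = int p ^ n"
  have P: "P > 0" using p_pos[OF p] by (simp add: P_def)
  have b: "digit_sum d n \<in> {0..<P}" using digit_sum_bounds[OF assms(1)] by (simp add: P_def)
  have dn: "d n \<in> {0..<int p}" using assms(1) by auto
  have c: "0 \<le> c" "c < int p * P" using Suc.prems by (auto simp: P_def)
  have q: "c div P \<in> {0..<int p}"
  proof -
    have "c div P * P \<le> c" 
      using pos_mod_sign[OF P, of c] div_mult_mod_eq[of c P] by linarith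
    then have "c div P * P < int p * P" using c by linarith
    then have "c div P < int p" using P by (simp add: mult_less_cancel_right)
    then show ?thesis using c P by (simp add: pos_imp_zdiv_nonneg_iff)
  qed
  have "digit_sum d (Suc n) = c \<longleftrightarrow> digit_sum d n = c mod P \<and> d n = c div P"
  proof
    assume "digit_sum d (Suc n) = c"
    then have c': "c = digit_sum d n + d n * P" by (simp add: digit_sum_Suc P_def)
    show "digit_sum d n = c mod P \<and> d n = c div P"
      using b P unfolding c' by simp
  next
    assume "digit_sum d n = c mod P \<and> d n = c div P"
    then show "digit_sum d (Suc n) = c" by (simp add: digit_sum_Suc P_def[symmetric])
  qed
  also have "digit_sum d n = c mod P \<longleftrightarrow> (\<forall>i<n. d i = c mod P div int p ^ i mod int p)"
    using P by (intro Suc.IH) (auto simp: P_def)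
  also have "\<dots> \<longleftrightarrow> (\<forall>i<n. d i = c div int p ^ i mod int p)"
  proof -
    have "c mod P div int p ^ i mod int p = c div int p ^ i mod int p" if "i < n" for i
    proof -
      have PP: "P = int p ^ i * (int p * int p ^ (n - Suc i))"
        using that by (simp add: P_def flip: power_Suc power_add)
      have "c mod P div int p ^ i = c div int p ^ i mod (int p * int p ^ (n - Suc i))"
        unfolding PP using p_pos[OF p] by (subst zmod_zmult2_eq) auto
      then show ?thesis by (simp add: mod_mod_cancel)
    qed
    then show ?thesis by auto
  qed
  also have "d n = c div P \<longleftrightarrow> d n = c div int p ^ n mod int p"
    using q by (simp add: P_def)
  finally show ?case by (auto simp: less_Suc_eq)
qed

lemma emeasure_digit_cyl:
  assumes c: "c \<in> {0..<int p ^ n}"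
  shows "digit_sum -` padic_cyl p n c \<inter> space digit_measure \<in> sets digit_measure"
    and "emeasure digit_measure (digit_sum -` padic_cyl p n c \<inter> space digit_measure)
      = ennreal (1 / real p ^ n)"
proof -
  interpret D: product_prob_space "\<lambda>_. uniform_count_measure {0..<int p}" UNIV
    unfolding product_prob_space_def product_prob_space_axioms_def product_sigma_finite_def
    using prob_space_digit prob_space_imp_sigma_finite by auto
  define X where "X i = {c div int p ^ i mod int p}" for i
  have X: "X i \<in> sets (uniform_count_measure {0..<int p})" for i
    using p_pos[OF p] by (simp add: X_def sets_uniform_count_measure)
  have eq: "digit_sum -` padic_cyl p n c \<inter> space digit_measure
      = {d \<in> space digit_measure. \<forall>i\<in>{..<n}. d i \<in> X i}"
  proof -
    have "digit_sum d \<in> padic_cyl p n c \<longleftrightarrow> (\<forall>i\<in>{..<n}. d i \<in> X i)"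
      if "d \<in> space digit_measure" for d
    proof -
      have d: "\<forall>i. d i \<in> {0..<int p}" using that by (simp add: space_digit_measure)
      show ?thesis
        using digit_sum_Zp[OF d] digit_sum_eq_iff[OF d c] by (auto simp: padic_cyl_def X_def)
    qed
    then show ?thesis by auto
  qed
  show "digit_sum -` padic_cyl p n c \<inter> space digit_measure \<in> sets digit_measure"
    unfolding eq unfolding digit_measure_def using X by measurable
  have "emeasure digit_measure (digit_sum -` padic_cyl p n c \<inter> space digit_measure)
      = (\<Prod>i<n. emeasure (uniform_count_measure {0..<int p}) (X i))"
    unfolding eq unfolding digit_measure_def by (rule D.emeasure_PiM_Collect) (auto simp: X)
  also have "\<dots> = (\<Prod>i<n. ennreal (1 / real p))"
    using p_pos[OF p] by (intro prod.cong refl) (simp add: X_def emeasure_uniform_count_measure)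
  also have "\<dots> = ennreal (1 / real p ^ n)"
    by (simp add: ennreal_power power_divide)
  finally show "emeasure digit_measure (digit_sum -` padic_cyl p n c \<inter> space digit_measure)
      = ennreal (1 / real p ^ n)" .
qed

lemma digit_sum_measurable: "digit_sum \<in> measurable digit_measure (padic_borel p)"
proof (rule measurable_sigma_sets[OF sets_padic_borel padic_cyls_Pow])
  show "digit_sum \<in> space digit_measure \<rightarrow> carrier (Zp p)"
    by (auto simp: space_digit_measure digit_sum_Zp)
  fix C assume "C \<in> padic_cyls p"
  then obtain n c where C: "C = padic_cyl p n c" by (auto simp: padic_cyls_def)
  show "digit_sum -` C \<inter> space digit_measure \<in> sets digit_measure"
    unfolding C using emeasure_digit_cyl(1)[of c n] padic_cyl_outside[of c p n]
    by (cases "c \<in> {0..<int p ^ n}") auto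
qed

lemma translate_measurable:
  assumes a: "a \<in> carrier (Zp p)"
  shows "(\<lambda>x. x \<ominus>\<^bsub>Zp p\<^esub> a) \<in> measurable (padic_borel p) (padic_borel p)"
proof (rule measurable_sigma_sets[OF sets_padic_borel padic_cyls_Pow])
  show "(\<lambda>x. x \<ominus>\<^bsub>Zp p\<^esub> a) \<in> space (padic_borel p) \<rightarrow> carrier (Zp p)"
    using a by (auto simp: space_padic_borel)
  fix C assume "C \<in> padic_cyls p"
  then obtain n c where C: "C = padic_cyl p n c" by (auto simp: padic_cyls_def)
  have "C \<subseteq> carrier (Zp p)" by (auto simp: C padic_cyl_def)
  then have "(\<lambda>x. x \<ominus>\<^bsub>Zp p\<^esub> a) -` C \<inter> space (padic_borel p) = a <+\<^bsub>Zp p\<^esub> C"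
    using translate_vimage[OF a] by (simp add: space_padic_borel)
  also have "\<dots> \<in> sets (padic_borel p)"
  proof (cases "c \<in> {0..<int p ^ n}")
    case True
    then show ?thesis unfolding C by (simp add: translate_cyl[OF a] padic_cyl_sets)
  next
    case False
    then show ?thesis unfolding C by (simp add: padic_cyl_outside a_l_coset_def l_coset_def)
  qed
  finally show "(\<lambda>x. x \<ominus>\<^bsub>Zp p\<^esub> a) -` C \<inter> space (padic_borel p) \<in> sets (padic_borel p)" .
qed

lemma is_padic_haar_digit: "is_padic_haar p (distr digit_measure (padic_borel p) digit_sum)"
proof -
  define H where "H = distr digit_measure (padic_borel p) digit_sum"
  have sets: "sets H = sets (padic_borel p)" by (simp add: H_def)
  have space: "space H = carrier (Zp p)" by (simp add: H_def space_padic_borel)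
  have cyl: "emeasure H (padic_cyl p n c) = ennreal (1 / real p ^ n)"
    if "c \<in> {0..<int p ^ n}" for n c
    unfolding H_def using that
    by (simp add: emeasure_distr digit_sum_measurable padic_cyl_sets emeasure_digit_cyl(2)
        del: atLeastLessThan_iff)
  have one: "emeasure H (carrier (Zp p)) = 1"
    using cyl[of 0 0] by (simp add: padic_cyl_0)
  have "emeasure H (a <+\<^bsub>Zp p\<^esub> S) = emeasure H S"
    if a: "a \<in> carrier (Zp p)" and S: "S \<in> sets H" for a S
  proof -
    have m: "(\<lambda>x. x \<ominus>\<^bsub>Zp p\<^esub> a) \<in> measurable H H"
      using translate_measurable[OF a] by (simp add: measurable_cong_sets[OF sets sets])
    have tr: "emeasure (distr H H (\<lambda>x. x \<ominus>\<^bsub>Zp p\<^esub> a)) T = emeasure H (a <+\<^bsub>Zp p\<^esub> T)"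
      if T: "T \<in> sets H" for T
    proof -
      have "T \<subseteq> carrier (Zp p)" using sets.sets_into_space[OF T] by (simp add: space)
      then show ?thesis using T by (simp add: emeasure_distr[OF m] translate_vimage[OF a] space)
    qed
    have "H = distr H H (\<lambda>x. x \<ominus>\<^bsub>Zp p\<^esub> a)"
    proof (rule measure_eqI_cyl)
      fix n c assume c: "c \<in> {0..<int p ^ n}"
      have "(a n + c) mod int p ^ n \<in> {0..<int p ^ n}" using p_pos[OF p] by simp
      then show "emeasure H (padic_cyl p n c)
          = emeasure (distr H H (\<lambda>x. x \<ominus>\<^bsub>Zp p\<^esub> a)) (padic_cyl p n c)"
        using c cyl by (simp add: tr sets padic_cyl_sets translate_cyl[OF a c]
            del: atLeastLessThan_iff)
    qed (auto simp: sets one)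
    then show ?thesis using tr[OF S] by simp
  qed
  then show ?thesis
    unfolding is_padic_haar_def H_def[symmetric] using sets one by auto
qed

lemma is_padic_haar_padic_haar: "is_padic_haar p (padic_haar p)"
  unfolding padic_haar_def
  by (rule theI[where P = "is_padic_haar p", OF is_padic_haar_digit])
     (rule is_padic_haar_unique[OF _ is_padic_haar_digit])

lemma sets_padic_haar: "sets (padic_haar p) = sets (padic_borel p)"
  using is_padic_haar_padic_haar by (simp add: is_padic_haar_def)

lemma space_padic_haar: "space (padic_haar p) = carrier (Zp p)"
  using sets_eq_imp_space_eq[OF sets_padic_haar] by (simp add: space_padic_borel)

lemma emeasure_padic_haar_ball:
  assumes "a \<in> carrier (Zp p)"
  shows "emeasure (padic_haar p) (a <+\<^bsub>Zp p\<^esub> padic_pow_ideal p k) = ennreal (1 / real p ^ k)"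
proof -
  have "padic_pow_ideal p k = padic_cyl p k 0"
    by (auto simp: padic_pow_ideal_iff[OF p] padic_cyl_def)
  then show ?thesis
    using assms p_pos[OF p]
    by (simp add: translate_cyl is_padic_haar_cyl[OF is_padic_haar_padic_haar])
qed

end

end

theory Submission
  imports Defs
begin

text \<open>
  On natural numbers the van der Put series is a finite sum, and truncating the leading digit of
  \<open>m \<ge> p\<close> removes exactly the term \<open>B m\<close>, so \<open>f m = f (m - q m) + B m\<close>. Under the two hypotheses the
  map that \<open>f\<close> induces on \<open>\<int>/p\<^sup>n\<close> is therefore injective: for \<open>n = 1\<close> this is the first
  hypothesis, and if \<open>a\<close> and \<open>b\<close> agree modulo \<open>p\<^sup>n\<close> with remainder \<open>r\<close>, then
  \<open>f a - f b \<equiv> (a - r) - (b - r)\<close> modulo \<open>p\<^sup>n\<^sup>+\<^sup>1\<close> by the second one. An injective self-map of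
  a finite set is a permutation, so the preimage of each ball is a ball of the same radius.
\<close>

section \<open>Base-p logarithms, leading digits and truncations\<close>

lemma floor_log_base_eq:
  assumes "p > 1" "p ^ s \<le> m" "m < p ^ Suc s"
  shows "floor_log_base p m = s"
proof -
  have "m > 0" using assms by (metis gr0I le_zero_eq power_not_zero not_less_zero)
  then have "\<lfloor>log (real p) (real m)\<rfloor> = int s"
    using assms floor_log_nat_eq_powr_iff[of p m s] by simp
  then show ?thesis by (simp add: floor_log_base_def)
qed

lemma less_power_Suc_floor_log_base:
  assumes "p > 1"
  shows "m < p ^ Suc (floor_log_base p m)"
proof (cases "m = 0")
  case False
  then obtain s where "p ^ s \<le> m" "m < p ^ Suc s"
    using assms ex_power_ivl1[of p m] by auto
  then show ?thesis using assms by (simp add: floor_log_base_eq del: power_Suc)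
qed (use assms in simp)

lemma floor_log_base_less:
  assumes "p > 1" "m < p ^ n" "n > 0"
  shows "floor_log_base p m < n"
proof (cases "m = 0")
  case True
  \<comment> \<open>The convention \<open>ln 0 = 0\<close> gives
    \<open>floor_log_base p 0 = 0\<close>, so the strict bound needs \<open>n > 0\<close>.\<close>
  then show ?thesis using assms by (simp add: floor_log_base_def log_def)
next
  case False
  then obtain s where s: "p ^ s \<le> m" "m < p ^ Suc s"
    using assms ex_power_ivl1[of p m] by auto
  then have "p ^ s < p ^ n" using assms by linarith
  then have "s < n" using assms by (simp add: power_strict_increasing_iff)
  then show ?thesis using assms s by (simp add: floor_log_base_eq del: power_Suc)
qed

text \<open>The quotient \<open>m div p ^ s\<close> is a single digit, so division with remainder by
  \<open>p ^ s\<close> splits off the leading term. Thus m - q(m) is \<open>m mod p ^ s\<close>; the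
  additive form avoids truncated subtraction.\<close>

lemma leading_term_eq:
  assumes "p > 1" "p ^ s \<le> m" "m < p ^ Suc s"
  shows "leading_term p m + m mod p ^ s = m"
proof -
  have "m div p ^ s < p" using assms by (simp add: less_mult_imp_div_less)
  then have "leading_term p m = m div p ^ s * p ^ s"
    using assms by (simp add: leading_term_def Let_def floor_log_base_eq del: power_Suc)
  then show ?thesis by (simp only: div_mult_mod_eq)
qed

text \<open>The indices \<open>k\<close> with \<open>\<chi>(k, m) = 1\<close>.\<close>

definition van_der_Put_support :: "nat \<Rightarrow> nat \<Rightarrow> nat set" where
  "van_der_Put_support p m = {k. m mod p ^ Suc (floor_log_base p k) = k}"

lemma van_der_Put_support_le: "k \<in> van_der_Put_support p m \<Longrightarrow> k \<le> m"
  using mod_less_eq_dividend[of m "p ^ Suc (floor_log_base p k)"]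
  by (simp add: van_der_Put_support_def del: power_Suc)

lemma finite_van_der_Put_support: "finite (van_der_Put_support p m)"
  using finite_subset[of _ "{..m}"] van_der_Put_support_le by blast

lemma van_der_Put_support_less:
  assumes "p > 1" "m < p"
  shows "van_der_Put_support p m = {m}"
proof -
  have "floor_log_base p k = 0" if "k \<le> m" for k
    using floor_log_base_less[of p k 1] assms that by simp
  then show ?thesis
    using assms van_der_Put_support_le by (fastforce simp: van_der_Put_support_def)
qed

text \<open>The support of \<open>m\<close> consists of truncations of its base-p expansion, and the
  leading digit contributes one new truncation, \<open>m\<close> itself. For \<open>s = 0\<close>
  this fails: the remainder is 0, which is not in the support of a nonzero digit.\<close>

lemma van_der_Put_support_rec:
  assumes "p > 1" "p ^ s \<le> m" "m < p ^ Suc s" "s > 0"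
  shows "van_der_Put_support p m = insert m (van_der_Put_support p (m mod p ^ s))"
proof -
  have r: "m mod p ^ s < p ^ s" using assms by simp
  have "k \<in> van_der_Put_support p m \<longleftrightarrow> k = m \<or> k \<in> van_der_Put_support p (m mod p ^ s)" for k
  proof (cases "k < p ^ s")
    case True
    \<comment> \<open>An index below \<open>p ^ s\<close> tests at most the lowest \<open>s\<close>
      digits, which \<open>m\<close> and \<open>m mod p ^ s\<close> share.\<close>
    then have "Suc (floor_log_base p k) \<le> s"
      using floor_log_base_less[OF assms(1) True assms(4)] by simp
    then have "m mod p ^ s mod p ^ Suc (floor_log_base p k) = m mod p ^ Suc (floor_log_base p k)"
      by (intro mod_mod_cancel le_imp_power_dvd)
    then show ?thesis using True assms by (auto simp: van_der_Put_support_def)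
  next
    case False
    then have "k \<notin> van_der_Put_support p (m mod p ^ s)"
      using van_der_Put_support_le r by force
    moreover have "k \<in> van_der_Put_support p m \<longleftrightarrow> k = m"
    proof (cases "k \<le> m")
      case True
      then have "floor_log_base p k = s"
        using False assms by (intro floor_log_base_eq) auto
      then show ?thesis using assms by (auto simp: van_der_Put_support_def)
    qed (use van_der_Put_support_le in auto)
    ultimately show ?thesis by simp
  qed
  then show ?thesis by blast
qed

section \<open>Values of the expansion at natural numbers\<close>

context
  fixes p :: nat
  assumes p: "prime p"
begin

interpretation Zp: cring "Zp p" by (rule cring_Zp[OF p])

lemma Zp_finsum_nth:
  assumes "finite A" "g \<in> A \<rightarrow> carrier (Zp p)"
  shows "(\<Oplus>\<^bsub>Zp p\<^esub>k\<in>A. g k) n = (\<Sum>k\<in>A. g k n) mod int p ^ n"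
  using assms
proof (induction A rule: finite_induct)
  case empty
  then show ?case by (simp add: Zp_zero)
next
  case (insert a A)
  then have "(\<Oplus>\<^bsub>Zp p\<^esub>k\<in>insert a A. g k) = g a \<oplus>\<^bsub>Zp p\<^esub> (\<Oplus>\<^bsub>Zp p\<^esub>k\<in>A. g k)"
    by (intro Zp.finsum_insert) auto
  then show ?case using insert by (simp add: Zp_add mod_simps)
qed

lemma van_der_Put_of_nat:
  "van_der_Put p k (padic_of_nat p m) =
    (if k \<in> van_der_Put_support p m then \<one>\<^bsub>Zp p\<^esub> else \<zero>\<^bsub>Zp p\<^esub>)"
proof -
  define s where "s = Suc (floor_log_base p k)"
  \<comment> \<open>The separate radius at \<open>k = 0\<close> fits the general formula because
    \<open>floor_log_base p 0 = 0\<close>.\<close>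
  have "(if k = 0 then 1 / real p else 1 / real p ^ (floor_log_base p k + 1)) = 1 / real p ^ s"
    by (auto simp: s_def floor_log_base_def log_def)
  moreover have "padic_abs p (padic_of_nat p m \<ominus>\<^bsub>Zp p\<^esub> padic_of_nat p k) \<le> 1 / real p ^ s
      \<longleftrightarrow> int m mod int p ^ s = int k mod int p ^ s"
    using padic_of_nat_closed[OF p]
    by (simp add: padic_abs_le_iff[OF p] Zp_minus_eq_0_iff[OF p] padic_of_nat_nth[OF p])
  moreover have "int m mod int p ^ s = int k mod int p ^ s \<longleftrightarrow> m mod p ^ s = k mod p ^ s"
    by (simp flip: of_nat_power zmod_int)
  moreover have "k mod p ^ s = k"
    using less_power_Suc_floor_log_base[OF p_gt_1[OF p], of k] by (simp add: s_def)
  moreover have "k \<in> van_der_Put_support p m \<longleftrightarrow> m mod p ^ s = k"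
    by (simp add: van_der_Put_support_def s_def)
  ultimately show ?thesis unfolding van_der_Put_def by simp
qed

text \<open>Convergence makes the residues modulo \<open>p ^ n\<close> of the partial sums
  eventually constant, and at a natural number only finitely many terms are nonzero, so the limit
  becomes a finite sum of integers.\<close>

lemma van_der_Put_expansion_of_nat:
  assumes exp: "van_der_Put_expansion p f B"
  shows "f (padic_of_nat p m) n = (\<Sum>k\<in>van_der_Put_support p m. B k n) mod int p ^ n"
proof -
  define x where "x = padic_of_nat p m"
  define S where "S N = (\<Oplus>\<^bsub>Zp p\<^esub>k\<in>{..<N}. B k \<otimes>\<^bsub>Zp p\<^esub> van_der_Put p k x)" for N
  have x: "x \<in> carrier (Zp p)" by (simp add: x_def padic_of_nat_closed[OF p])
  have B: "B k \<in> carrier (Zp p)" for k using exp by (simp add: van_der_Put_expansion_def)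
  have lim: "limitin (padic_topology p) S (f x) sequentially"
    using exp x unfolding van_der_Put_expansion_def S_def by blast
  then have "f x \<in> carrier (Zp p)"
    using openin_padic_iff[OF p, of "topspace (padic_topology p)"] limitin_topspace[OF lim] by auto
  then have "f x \<in> padic_cyl p n (f x n)" by (simp add: padic_cyl_def)
  then have "eventually (\<lambda>N. S N \<in> padic_cyl p n (f x n)) sequentially"
    using lim openin_padic_cyl[OF p] unfolding limitin_def by blast
  \<comment> \<open>Beyond \<open>m\<close> the partial sum contains the whole support.\<close>
  moreover have "eventually (\<lambda>N. N > m) sequentially" by (rule eventually_gt_at_top)
  ultimately have "eventually (\<lambda>N. S N \<in> padic_cyl p n (f x n) \<and> N > m) sequentially"
    by (rule eventually_conj)
  then obtain N where N: "S N n = f x n" "N > m"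
    unfolding eventually_sequentially padic_cyl_def by auto
  have vdp: "van_der_Put p k x \<in> carrier (Zp p)" for k
    using Zp_zero_one[OF p] by (simp add: van_der_Put_def)
  have term_eq: "(B k \<otimes>\<^bsub>Zp p\<^esub> van_der_Put p k x) n
      = (if k \<in> van_der_Put_support p m then B k n else 0)" for k
    using B[of k] by (simp add: x_def van_der_Put_of_nat)(simp add: Zp_zero)
  have "f x n = (\<Sum>k<N. if k \<in> van_der_Put_support p m then B k n else 0) mod int p ^ n"
    using N(1) B vdp unfolding S_def by (subst (asm) Zp_finsum_nth) (auto simp: term_eq)
  also have "(\<Sum>k<N. if k \<in> van_der_Put_support p m then B k n else 0)
      = (\<Sum>k\<in>van_der_Put_support p m. B k n)"
    using N(2)
    by (subst sum.inter_restrict[symmetric])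
       (auto intro!: sum.cong dest: van_der_Put_support_le)
  finally show ?thesis by (simp add: x_def)
qed

lemma van_der_Put_coeff_less:
  assumes "van_der_Put_expansion p f B" "m < p"
  shows "f (padic_of_nat p m) n = B m n"
  using assms van_der_Put_expansion_of_nat[OF assms(1), of m n]
  by (simp add: van_der_Put_support_less[OF p_gt_1[OF p]] van_der_Put_expansion_def Zp_mod_self)

text \<open>This is the coefficient formula B_m = f(m) - f(m - q(m)) read modulo
  \<open>p ^ n\<close>: passing from \<open>m mod p ^ s\<close> to \<open>m\<close> adds the single
  index \<open>m\<close> to the support.\<close>

lemma van_der_Put_coeff_rec:
  assumes "van_der_Put_expansion p f B" "p ^ s \<le> m" "m < p ^ Suc s" "s > 0"
  shows "f (padic_of_nat p m) n = (B m n + f (padic_of_nat p (m mod p ^ s)) n) mod int p ^ n"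
proof -
  have "m mod p ^ s < p ^ s" using p_pos[OF p] by simp
  then have "m \<notin> van_der_Put_support p (m mod p ^ s)"
    using van_der_Put_support_le[of m p "m mod p ^ s"] assms(2) by linarith
  then show ?thesis
    using finite_van_der_Put_support
    by (simp add: van_der_Put_expansion_of_nat[OF assms(1)] mod_simps
        van_der_Put_support_rec[OF p_gt_1[OF p] assms(2-4)])
qed

section \<open>Induced maps on residues and preservation of measure\<close>

lemma padic_one_lipschitz_nth:
  assumes "padic_one_lipschitz p f" "f \<in> carrier (Zp p) \<rightarrow> carrier (Zp p)"
    and "x \<in> carrier (Zp p)" "y \<in> carrier (Zp p)" "x n = y n"
  shows "f x n = f y n"
proof -
  have "padic_abs p (f x \<ominus>\<^bsub>Zp p\<^esub> f y) \<le> padic_abs p (x \<ominus>\<^bsub>Zp p\<^esub> y)"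
    using assms by (simp add: padic_one_lipschitz_def)
  also have "\<dots> \<le> 1 / real p ^ n"
    using assms by (simp add: padic_abs_le_iff[OF p] Zp_minus_eq_0_iff[OF p])
  finally show ?thesis
    using assms by (simp add: padic_abs_le_iff[OF p] Zp_minus_eq_0_iff[OF p] Pi_iff)
qed

text \<open>The two directions of \<open>iff\<close> say that the map induced on residues modulo
  \<open>p ^ n\<close> is well defined and injective, hence bijective. So the preimage of a cylinder
  is a cylinder of the same level and measure.\<close>

lemma padic_measure_preservingI:
  assumes f: "f \<in> carrier (Zp p) \<rightarrow> carrier (Zp p)"
    and iff: "\<And>n x y. x \<in> carrier (Zp p) \<Longrightarrow> y \<in> carrier (Zp p) \<Longrightarrow> f x n = f y n \<longleftrightarrow> x n = y n"
  shows "padic_measure_preserving p f"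
proof -
  let ?H = "padic_haar p"
  have cyl: "\<exists>d\<in>{0..<int p ^ n}. f -` padic_cyl p n c \<inter> carrier (Zp p) = padic_cyl p n d"
    if c: "c \<in> {0..<int p ^ n}" for n c
  proof -
    \<comment> \<open>The induced map on residues, computed on natural representatives.\<close>
    define g where "g d = f (padic_of_nat p (nat d)) n" for d
    have nth: "padic_of_nat p (nat d) n = d" if "d \<in> {0..<int p ^ n}" for d
      using that by (simp add: padic_of_nat_nth[OF p])
    have fg: "f x n \<in> {0..<int p ^ n}" if "x \<in> carrier (Zp p)" for x
      using f that Zp_carrier_iff[of "f x" p] by auto
    have "inj_on g {0..<int p ^ n}"
      using iff[OF padic_of_nat_closed[OF p] padic_of_nat_closed[OF p]] nth
      unfolding g_def inj_on_def by metis
    moreover have "g ` {0..<int p ^ n} \<subseteq> {0..<int p ^ n}"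
      unfolding g_def using fg[OF padic_of_nat_closed[OF p]] by blast
    ultimately have "g ` {0..<int p ^ n} = {0..<int p ^ n}"
      by (intro endo_inj_surj) auto
    then have "c \<in> g ` {0..<int p ^ n}" using c by (simp only:)
    then obtain d where d: "d \<in> {0..<int p ^ n}" "c = g d" by (rule imageE)
    have "f x n = c \<longleftrightarrow> x n = d" if "x \<in> carrier (Zp p)" for x
      using iff[OF that padic_of_nat_closed[OF p, of "nat d"], of n] d(2) nth[OF d(1)]
      by (simp add: g_def)
    then show ?thesis using d(1) f by (intro bexI[of _ d]) (auto simp: padic_cyl_def)
  qed
  have sets_vimage: "f -` C \<inter> carrier (Zp p) \<in> sets ?H" if "C \<in> padic_cyls p" for C
  proof -
    obtain n c where C: "C = padic_cyl p n c" using \<open>C \<in> padic_cyls p\<close> by (auto simp: padic_cyls_def)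
    show ?thesis
      unfolding C using cyl[of c n] padic_cyl_outside[of c p n] padic_cyl_sets[OF p]
      by (cases "c \<in> {0..<int p ^ n}") (auto simp: sets_padic_haar[OF p])
  qed
  have meas: "f \<in> measurable ?H ?H"
    by (rule measurable_sigma_sets[OF _ padic_cyls_Pow])
       (use f sets_vimage in \<open>auto simp: sets_padic_haar[OF p] sets_padic_borel[OF p] space_padic_haar[OF p]\<close>)
  have haar_cyl: "emeasure ?H (padic_cyl p n c) = ennreal (1 / real p ^ n)"
    if "c \<in> {0..<int p ^ n}" for n c
    using is_padic_haar_cyl[OF p is_padic_haar_padic_haar[OF p] that] .
  \<comment> \<open>Cylinders form an intersection-stable generator of the Borel sets, so it
    suffices to compare both measures on them.\<close>
  have "?H = distr ?H ?H f"
  proof (rule measure_eqI_cyl[OF p])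
    fix n c assume c: "c \<in> {0..<int p ^ n}"
    then obtain d where d: "d \<in> {0..<int p ^ n}"
      "f -` padic_cyl p n c \<inter> carrier (Zp p) = padic_cyl p n d"
      using cyl by blast
    have "emeasure (distr ?H ?H f) (padic_cyl p n c)
        = emeasure ?H (f -` padic_cyl p n c \<inter> carrier (Zp p))"
      using meas padic_cyl_sets[OF p]
      by (simp add: emeasure_distr sets_padic_haar[OF p] space_padic_haar[OF p])
    also have "\<dots> = emeasure ?H (padic_cyl p n c)"
      using haar_cyl[OF d(1)] haar_cyl[OF c] d(2) by simp
    finally show "emeasure ?H (padic_cyl p n c) = emeasure (distr ?H ?H f) (padic_cyl p n c)" ..
  next
    show "emeasure ?H (carrier (Zp p)) \<noteq> \<infinity>"
      using is_padic_haar_padic_haar[OF p] by (simp add: is_padic_haar_def)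
  qed (simp_all add: sets_padic_haar[OF p])
  have "emeasure ?H (f -` S \<inter> carrier (Zp p)) = emeasure ?H S" if "S \<in> sets ?H" for S
    using emeasure_distr[OF meas that] \<open>?H = distr ?H ?H f\<close>
    by (simp add: space_padic_haar[OF p])
  then show ?thesis using meas by (simp add: padic_measure_preserving_def)
qed

section \<open>Injectivity modulo powers of p\<close>

lemma van_der_Put_nth_inj:
  assumes f: "f \<in> carrier (Zp p) \<rightarrow> carrier (Zp p)"
    and lip: "padic_one_lipschitz p f"
    and exp: "van_der_Put_expansion p f B"
    and B1: "\<And>i j. i < p \<Longrightarrow> j < p \<Longrightarrow> i \<noteq> j \<Longrightarrow> \<not> padic_cong p 1 (B i) (B j)"
    and B2: "\<And>m. m \<ge> p \<Longrightarrow>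
      padic_cong p (floor_log_base p m + 1) (B m) (padic_of_nat p (leading_term p m))"
    and "a < p ^ n" "b < p ^ n" "f (padic_of_nat p a) n = f (padic_of_nat p b) n"
  shows "a = b"
  using assms(6-)
proof (induction n arbitrary: a b)
  case 0
  then show ?case by simp
next
  case (Suc n)
  note closed = padic_of_nat_closed[OF p]
  have B: "B k \<in> carrier (Zp p)" for k using exp by (simp add: van_der_Put_expansion_def)
  show ?case
  \<comment> \<open>Level 1 needs hypothesis \<open>B1\<close>, since \<open>B2\<close> says nothing
    about indices below \<open>p\<close>.\<close>
  proof (cases "n = 0")
    case True
    then have "a < p" "b < p" "B a 1 = B b 1"
      using Suc.prems van_der_Put_coeff_less[OF exp] by auto
    then show ?thesis using B1[of a b] padic_cong_iff[OF p B B] by blast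
  next
    case n: False
    define P where "P = int p ^ Suc n"
    \<comment> \<open>Modulo \<open>P\<close>, restoring the digit at position \<open>n\<close>
      changes the value of \<open>f\<close> by exactly the amount added to the argument. If that
      digit is 0, nothing changes.\<close>
    have step: "f (padic_of_nat p m) (Suc n) mod P
        = (f (padic_of_nat p (m mod p ^ n)) (Suc n) + int m - int (m mod p ^ n)) mod P"
      if m: "m < p ^ Suc n" for m
    proof (cases "m < p ^ n")
      case True
      then show ?thesis by simp
    next
      case False
      then have ge: "p ^ n \<le> m" by simp
      have "p ^ 1 \<le> p ^ n" using n p_gt_1[OF p] by (intro power_increasing) auto
      then have "padic_cong p (Suc n) (B m) (padic_of_nat p (leading_term p m))"
        using B2[of m] floor_log_base_eq[OF p_gt_1[OF p] ge m] ge by simp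
      then have "B m (Suc n) = int (leading_term p m) mod P"
        using padic_cong_iff[OF p B closed] padic_of_nat_nth[OF p] by (simp add: P_def)
      moreover have "int (leading_term p m) = int m - int (m mod p ^ n)"
        using leading_term_eq[OF p_gt_1[OF p] ge m] by linarith
      ultimately show ?thesis
        using van_der_Put_coeff_rec[OF exp ge m, of "Suc n"] n
        by (simp add: mod_simps algebra_simps flip: P_def del: power_Suc)
    qed
    \<comment> \<open>By the Lipschitz property, equality of values modulo \<open>p ^ Suc n\<close>
      descends to the truncated arguments modulo \<open>p ^ n\<close>, as the induction hypothesis
      requires.\<close>
    have red: "f (padic_of_nat p (m mod p ^ n)) n = f (padic_of_nat p m) (Suc n) mod int p ^ n" for m
    proof -
      have "f (padic_of_nat p (m mod p ^ n)) n = f (padic_of_nat p m) n"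
        by (rule padic_one_lipschitz_nth[OF lip f closed closed])
           (simp add: padic_of_nat_nth[OF p] zmod_int)
      also have "\<dots> = f (padic_of_nat p m) (Suc n) mod int p ^ n"
        using f closed by (intro Zp_mod[symmetric]) auto
      finally show ?thesis .
    qed
    have r: "a mod p ^ n = b mod p ^ n"
      using Suc.prems red p_pos[OF p] by (intro Suc.IH) simp_all
    \<comment> \<open>Both arguments have the same truncation, so its value under \<open>f\<close>
      cancels and only \<open>a\<close> and \<open>b\<close> remain.\<close>
    have "(f (padic_of_nat p (a mod p ^ n)) (Suc n) + int a - int (a mod p ^ n)) mod P
        = (f (padic_of_nat p (a mod p ^ n)) (Suc n) + int b - int (a mod p ^ n)) mod P"
      using step[OF Suc.prems(1)] step[OF Suc.prems(2)] Suc.prems(3) r by simp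
    then have "P dvd int a - int b" by (simp add: mod_eq_dvd_iff)
    then have "int a mod P = int b mod P" by (simp add: mod_eq_dvd_iff)
    then have "a mod p ^ Suc n = b mod p ^ Suc n"
      by (simp add: P_def flip: of_nat_power zmod_int del: power_Suc)
    then show ?thesis using Suc.prems by (simp del: power_Suc)
  qed
qed

end

theorem theorem3p2:
  fixes p :: nat
    and f :: "(nat \<Rightarrow> int) \<Rightarrow> (nat \<Rightarrow> int)"
    and B :: "nat \<Rightarrow> (nat \<Rightarrow> int)"
  assumes "prime p"
    and "f \<in> carrier (Zp p) \<rightarrow> carrier (Zp p)"
    and "padic_one_lipschitz p f"
    and "van_der_Put_expansion p f B"
    and "\<And>i j. i < p \<Longrightarrow> j < p \<Longrightarrow> i \<noteq> j \<Longrightarrow> \<not> padic_cong p 1 (B i) (B j)"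
    and "\<And>m. m \<ge> p \<Longrightarrow>
      padic_cong p (floor_log_base p m + 1) (B m) (padic_of_nat p (leading_term p m))"
  shows "padic_measure_preserving p f"
proof (rule padic_measure_preservingI[OF assms(1,2)])
  note closed = padic_of_nat_closed[OF assms(1)]
  note lip = padic_one_lipschitz_nth[OF assms(1,3,2)]
  fix n x y assume x: "x \<in> carrier (Zp p)" and y: "y \<in> carrier (Zp p)"
  \<comment> \<open>Each p-adic integer shares its residue modulo \<open>p ^ n\<close> with a
    natural number below \<open>p ^ n\<close>; the Lipschitz property then reduces injectivity on
    residues to natural arguments.\<close>
  have trunc: "nat (z n) < p ^ n" "padic_of_nat p (nat (z n)) n = z n"
    if "z \<in> carrier (Zp p)" for z
  proof -
    have "0 \<le> z n" "z n < int p ^ n" using that unfolding Zp_carrier_iff by blast+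
    then show "nat (z n) < p ^ n" "padic_of_nat p (nat (z n)) n = z n"
      by (simp_all add: padic_of_nat_nth[OF assms(1)] nat_less_iff)
  qed
  show "f x n = f y n \<longleftrightarrow> x n = y n"
  proof
    assume "f x n = f y n"
    then have "f (padic_of_nat p (nat (x n))) n = f (padic_of_nat p (nat (y n))) n"
      using lip[OF closed x trunc(2)[OF x]] lip[OF closed y trunc(2)[OF y]] by simp
    then have "nat (x n) = nat (y n)"
      using van_der_Put_nth_inj[OF assms(1-6)] trunc(1) x y by blast
    then show "x n = y n" using Zp_carrier_iff x y eq_nat_nat_iff by blast
  qed (rule lip[OF x y])
qed

end
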